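(* For every integer $m\ge 0$, $$\sum_{k=2}^\infty (\zeta(k)-1) \frac{F_{k+m-1}}{k} = (1-\gamma)F_{m} - \frac{\ln\Gamma(\alpha)}{\sqrt{5}} L_{m-1} + F_{m-1}\ln\alpha + \frac{\alpha^{m-1}}{\sqrt{5}} \ln\Big(-\frac{\pi}{\alpha^2} \sec\frac{\sqrt{5}\,\pi}{2}\Big)$$ and $$\sum_{k=2}^\infty (\zeta(k)-1) \frac{L_{k+m-1}}{k}= (1-\gamma)L_{m} - \sqrt{5}\, \ln\Gamma(\alpha)\, F_{m-1} + L_{m-1}\ln\alpha + \alpha^{m-1} \ln\Big(-\frac{\pi}{\alpha^2} \sec\frac{\sqrt{5}\,\pi}{2}\Big),$$ where $\gamma$ is the Euler-Mascheroni constant and $\alpha=\frac{1+\sqrt5}{2}$.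
   Context: $\zeta$ is the Riemann zeta function, $\zeta(s)=\sum_{n\ge1} n^{-s}$ for $\Re(s)>1$; $\Gamma$ is the gamma function; $\gamma=\lim_{n\to\infty}\big(\sum_{k=1}^n \frac1k-\ln n\big)$; $\sec x = 1/\cos x$; $\ln$ is the real natural logarithm. The Fibonacci numbers $F_n$ and Lucas numbers $L_n$ are defined by $F_0=0$, $F_1=1$, $L_0=2$, $L_1=1$, $F_{n+2}=F_{n+1}+F_n$, $L_{n+2}=L_{n+1}+L_n$, and are extended to negative indices by $F_{-n}=(-1)^{n+1}F_n$ and $L_{-n}=(-1)^nL_n$ (so $F_{-1}=1$, $L_{-1}=-1$). *)

theory Defs
  imports "HOL-Analysis.Analysis" "HOL-Number_Theory.Fib"
begin

text \<open>
  The Dirichlet series of the Riemann zeta function, for real or complex arguments.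
  It represents the zeta function only for \<open>Re s > 1\<close>; no analytic continuation is
  built in, and the value carries no meaning outside this half-plane.
\<close>
definition zeta :: "'a::{real_normed_field, ln} \<Rightarrow> 'a" where
  "zeta s = (\<Sum>n. of_nat (Suc n) powr (- s))"

definition sec :: "real \<Rightarrow> real" where
  "sec x = 1 / cos x"

fun lucas :: "nat \<Rightarrow> nat" where
  "lucas 0 = 2"
| "lucas (Suc 0) = 1"
| "lucas (Suc (Suc n)) = lucas (Suc n) + lucas n"

text \<open>
  Extensions to negative indices by \<open>F(-n) = (-1)^(n+1) F(n)\<close> and
  \<open>L(-n) = (-1)^n L(n)\<close>.
\<close>
definition fib_int :: "int \<Rightarrow> int" where
  "fib_int n = (if n \<ge> 0 then int (fib (nat n))
                else (- 1) ^ (nat (- n) + 1) * int (fib (nat (- n))))"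

definition lucas_int :: "int \<Rightarrow> int" where
  "lucas_int n = (if n \<ge> 0 then int (lucas (nat n))
                  else (- 1) ^ nat (- n) * int (lucas (nat (- n))))"

definition golden :: real where
  "golden = (1 + sqrt 5) / 2"

end

theory Submission
  imports Defs "HOL-Real_Asymp.Real_Asymp"
begin

text \<open>
  Both identities come from one generating function: for \<open>\<bar>z\<bar> < 2\<close>,
  \[ \sum_{k\ge2} (\zeta(k)-1) \frac{z^k}{k} = \ln\Gamma(2-z) + (1-\gamma) z. \]
  It holds because \<open>\<zeta>(k) - 1\<close> is the sum of \<open>1/n^k\<close> over \<open>n \<ge> 2\<close>. Summing the
  resulting double series over \<open>k\<close> first turns the \<open>n\<close>-th row into
  \<open>-ln (1 - z/n) - z/n\<close>, and the sum of these rows is Euler's limit for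
  \<open>ln \<Gamma>(2 - z)\<close>, up to the linear term contributed by the harmonic numbers.
  Dropping the term \<open>n = 1\<close> of the zeta function is what moves the radius of convergence
  from 1 to 2, so that the golden ratio \<open>\<alpha>\<close> lies inside the disc.

  By Binet's formulas, the Fibonacci and Lucas series are the difference (over
  \<open>sqrt 5\<close>) and the sum of the generating function at \<open>\<alpha>\<close> and at its conjugate
  \<open>\<beta> = 1 - \<alpha>\<close>, weighted by \<open>\<alpha>^(m-1)\<close> and \<open>\<beta>^(m-1)\<close>. It remains to express the two Gamma
  values by \<open>\<Gamma>(\<alpha>)\<close>: the functional equation gives \<open>\<Gamma>(2 - \<beta>) = \<Gamma>(\<alpha> + 1) = \<alpha> \<Gamma>(\<alpha>)\<close>,
  and the reflection formula gives \<open>\<Gamma>(2 - \<alpha>) \<Gamma>(\<alpha>) = (1 - \<alpha>) \<pi> / sin (\<pi> \<alpha>)\<close>, where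
  \<open>sin (\<pi> \<alpha>) = cos (sqrt 5 \<pi> / 2)\<close> is the source of the secant.
\<close>

section \<open>The generating function of \<open>(\<zeta>(k) - 1) / k\<close>\<close>

lemma ln_series_without_linear_term:
  fixes t :: real
  assumes "\<bar>t\<bar> < 1"
  shows "(\<lambda>k. t ^ (k + 2) / real (k + 2)) sums (- ln (1 - t) - t)"
proof -
  have "(\<lambda>n. - (t ^ n / real n)) sums ln (1 - t)"
    using ln_series'[of "- t"] assms by simp
  hence "(\<lambda>n. t ^ n / real n) sums - ln (1 - t)"
    using sums_minus by fastforce
  hence "(\<lambda>k. t ^ (k + 2) / real (k + 2)) sums (- ln (1 - t) - (\<Sum>n<2. t ^ n / real n))"
    by (rule sums_split_initial_segment)
  thus ?thesis by (simp add: lessThan_Suc numeral_2_eq_2)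
qed

text \<open>
  Writing \<open>1 + (2 - z)/k = (1 - z/(k+2)) (k+2)/k\<close> turns the product in Euler's limit for
  \<open>\<Gamma>(2 - z)\<close> into the wanted one times a telescoping product, whose logarithm is that of
  \<open>(n+1)(n+2)\<close> up to the constant \<open>ln 2\<close>. The linear terms add up to a harmonic number.
  The term \<open>(2 - z) ln n\<close> of Euler's limit is left out: without it, every step from \<open>n\<close> to
  \<open>n + 1\<close>, also the one from 0, is the factorisation above.
\<close>
lemma sum_ln_one_minus_eq_Gamma_partial:
  fixes z :: real
  assumes "z < 2"
  shows "(\<Sum>k<Suc n. - ln (1 - z / real (k + 2)) - z / real (k + 2)) =
           - ln (2 - z) - (\<Sum>k=1..n. ln ((2 - z) / real k + 1))
           + ln (real n + 1) + ln (real n + 2) - z * (harm (n + 2) - 1)"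
proof (induction n)
  case 0
  have "ln (1 - z / 2) = ln (2 - z) - ln 2"
    using assms ln_div[of "2 - z" 2] by (simp add: diff_divide_distrib)
  moreover have "harm (0 + 2) = (3 / 2 :: real)"
    by (simp add: harm_def numeral_2_eq_2)
  ultimately show ?case by (simp add: algebra_simps del: add_0)
next
  case (Suc n)
  have "(2 - z) / real (Suc n) + 1 = (real n + 3 - z) / (real n + 1)"
    by (simp add: field_simps)
  hence A: "ln ((2 - z) / real (Suc n) + 1) = ln (real n + 3 - z) - ln (real n + 1)"
    using assms by (simp add: ln_div)
  have "1 - z / real (Suc n + 2) = (real n + 3 - z) / (real n + 3)"
    by (simp add: field_simps)
  hence B: "ln (1 - z / real (Suc n + 2)) = ln (real n + 3 - z) - ln (real n + 3)"
    using assms by (simp add: ln_div)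
  have C: "harm (Suc n + 2) = harm (n + 2) + 1 / (real n + 3)"
    using harm_Suc[of "n + 2", where 'a = real] by (simp add: inverse_eq_divide add_ac)
  have D: "(\<Sum>k=1..Suc n. ln ((2 - z) / real k + 1)) =
             (\<Sum>k=1..n. ln ((2 - z) / real k + 1)) + (ln (real n + 3 - z) - ln (real n + 1))"
    by (simp add: A del: of_nat_Suc)
  show ?case
    unfolding sum.lessThan_Suc[of _ "Suc n"] Suc.IH B C D
    by (simp add: algebra_simps)
qed

text \<open>
  In the partial sums, \<open>ln (n+1) + ln (n+2)\<close> and \<open>-z harm (n+2)\<close> together grow like
  \<open>(2 - z) ln n\<close>, which is exactly the divergent term of Euler's limit; the Euler-Mascheroni
  constant is what remains of the harmonic number.
\<close>
lemma sums_ln_Gamma_two_minus: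
  fixes z :: real
  assumes "z < 2"
  shows "(\<lambda>n. - ln (1 - z / real (n + 2)) - z / real (n + 2))
           sums (ln (Gamma (2 - z)) + (1 - euler_mascheroni) * z)"
proof -
  have 1: "ln_Gamma_series (2 - z) \<longlonglongrightarrow> ln (Gamma (2 - z))"
    using ln_Gamma_real_LIMSEQ[of "2 - z"] assms by (simp add: ln_Gamma_real_pos)
  have 2: "(\<lambda>n. ln (real n + 1) + ln (real n + 2) - 2 * ln (real n)) \<longlonglongrightarrow> 0"
    by real_asymp
  have 3: "(\<lambda>n. ln (real (n + 2)) - ln (real n)) \<longlonglongrightarrow> 0"
    by real_asymp
  have 4: "(\<lambda>n. harm (n + 2) - ln (real (n + 2))) \<longlonglongrightarrow> euler_mascheroni"
    by (rule LIMSEQ_ignore_initial_segment[OF euler_mascheroni_LIMSEQ])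
  have "(\<lambda>n. ln_Gamma_series (2 - z) n + (ln (real n + 1) + ln (real n + 2) - 2 * ln (real n))
           - z * ((harm (n + 2) - ln (real (n + 2))) + (ln (real (n + 2)) - ln (real n)) - 1))
          \<longlonglongrightarrow> ln (Gamma (2 - z)) + 0 - z * (euler_mascheroni + 0 - 1)"
    by (intro tendsto_intros 1 2 3 4)
  also have "(\<lambda>n. ln_Gamma_series (2 - z) n
           + (ln (real n + 1) + ln (real n + 2) - 2 * ln (real n))
           - z * ((harm (n + 2) - ln (real (n + 2))) + (ln (real (n + 2)) - ln (real n)) - 1))
        = (\<lambda>n. \<Sum>k<Suc n. - ln (1 - z / real (k + 2)) - z / real (k + 2))"
    unfolding sum_ln_one_minus_eq_Gamma_partial[OF assms]
    by (simp add: ln_Gamma_series_def algebra_simps)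
  finally show ?thesis
    unfolding sums_def by (subst (asm) filterlim_sequentially_Suc) (simp add: algebra_simps)
qed

lemma zeta_minus_one_sums:
  assumes "k \<ge> 2"
  shows "(\<lambda>n. 1 / real (n + 2) ^ k) sums (zeta (real k) - 1)"
proof -
  have eq: "real (Suc n) powr (- real k) = 1 / real (Suc n) ^ k" for n
    by (simp add: powr_minus powr_realpow divide_inverse)
  have "summable (\<lambda>n. inverse (real n ^ k))"
    using assms by (rule inverse_power_summable)
  hence "summable (\<lambda>n. 1 / real (Suc n) ^ k)"
    by (subst (asm) summable_Suc_iff [symmetric]) (simp add: divide_inverse)
  hence "(\<lambda>n. 1 / real (Suc n) ^ k) sums zeta (real k)"
    unfolding zeta_def eq by (rule summable_sums)
  hence "(\<lambda>n. 1 / real (Suc (Suc n)) ^ k) sums (zeta (real k) - 1 / real (Suc 0) ^ k)"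
    by (subst sums_Suc_iff) simp
  thus ?thesis by simp
qed

text \<open>
  The exchange of the two summations is justified by absolute convergence. The double series
  of absolute values is the same double series at \<open>\<bar>z\<bar>\<close>, which is again less than 2, so its
  row sums converge by the preceding lemmas.
\<close>
theorem zeta_minus_one_generating_function:
  fixes z :: real
  assumes "\<bar>z\<bar> < 2"
  shows "(\<lambda>k. (zeta (real (k + 2)) - 1) * z ^ (k + 2) / real (k + 2))
           sums (ln (Gamma (2 - z)) + (1 - euler_mascheroni) * z)"
proof -
  define f where "f = (\<lambda>w (n, k). (w / real (n + 2)) ^ (k + 2) / real (k + 2))"
  define g where "g = (\<lambda>w n. - ln (1 - w / real (n + 2)) - w / real (n + 2))"
  have small: "\<bar>w / real (n + 2)\<bar> < 1" if "\<bar>w\<bar> < 2" for w n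
    using that by (simp add: abs_if field_simps split: if_splits)
  have inner: "(\<lambda>k. f w (n, k)) sums g w n" if "\<bar>w\<bar> < 2" for w n
    using ln_series_without_linear_term[OF small[OF that]] by (simp add: f_def g_def)
  have norm_f: "norm (f z p) = f \<bar>z\<bar> p" for p
    by (cases p) (simp add: f_def abs_mult power_abs)
  have nonneg: "f \<bar>z\<bar> p \<ge> 0" for p
    unfolding norm_f[symmetric] by simp
  have abs_inner: "((\<lambda>k. f \<bar>z\<bar> (n, k)) has_sum g \<bar>z\<bar> n) UNIV" for n
    using assms by (intro sums_nonneg_imp_has_sum inner nonneg) auto
  have g_abs_nonneg: "g \<bar>z\<bar> n \<ge> 0" for n
    by (rule has_sum_nonneg[OF abs_inner nonneg])
  have g_abs_sum: "g \<bar>z\<bar> summable_on UNIV"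
  proof -
    have "g \<bar>z\<bar> sums (ln (Gamma (2 - \<bar>z\<bar>)) + (1 - euler_mascheroni) * \<bar>z\<bar>)"
      unfolding g_def using assms by (rule sums_ln_Gamma_two_minus)
    thus ?thesis
      unfolding summable_on_def using sums_nonneg_imp_has_sum g_abs_nonneg by blast
  qed
  have "f \<bar>z\<bar> summable_on (UNIV \<times> UNIV)"
    by (rule summable_on_SigmaI[OF abs_inner g_abs_sum nonneg])
  hence "(\<lambda>p. norm (f z p)) summable_on (UNIV \<times> UNIV)"
    by (simp only: norm_f)
  hence summ: "f z summable_on (UNIV \<times> UNIV)"
    by (rule abs_summable_summable)
  have inner_has: "((\<lambda>k. f z (n, k)) has_sum g z n) UNIV" for n
  proof (rule norm_summable_imp_has_sum)
    show "summable (\<lambda>k. norm (f z (n, k)))"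
      unfolding norm_f using abs_inner[of n] has_sum_imp_sums sums_summable by blast
  qed (rule inner[OF assms])
  define S where "S = infsum (f z) (UNIV \<times> UNIV)"
  have S: "(f z has_sum S) (UNIV \<times> UNIV)"
    unfolding S_def using summ by (rule has_sum_infsum)
  \<comment> \<open>Summation by rows evaluates \<open>S\<close>; summation by columns then gives the zeta series.\<close>
  have "(g z has_sum S) UNIV"
    by (rule has_sum_SigmaD[OF S inner_has])
  moreover have "g z sums (ln (Gamma (2 - z)) + (1 - euler_mascheroni) * z)"
    unfolding g_def using assms by (intro sums_ln_Gamma_two_minus) auto
  ultimately have S_eq: "S = ln (Gamma (2 - z)) + (1 - euler_mascheroni) * z"
    using has_sum_imp_sums sums_unique2 by blast
  have S': "((\<lambda>(k, n). f z (n, k)) has_sum S) (UNIV \<times> UNIV)"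
    using S by (subst (asm) has_sum_swap)
  have col: "((\<lambda>n. f z (n, k)) has_sum ((zeta (real (k + 2)) - 1) * z ^ (k + 2) / real (k + 2))) UNIV"
    for k
  proof (rule norm_summable_imp_has_sum)
    have Z: "(\<lambda>n. c ^ (k + 2) / real (k + 2) * (1 / real (n + 2) ^ (k + 2)))
            sums (c ^ (k + 2) / real (k + 2) * (zeta (real (k + 2)) - 1))" for c
      by (intro sums_mult zeta_minus_one_sums) simp
    have f_eq: "f c (n, k) = c ^ (k + 2) / real (k + 2) * (1 / real (n + 2) ^ (k + 2))" for c n
      by (simp only: f_def prod.case power_divide) simp
    show "(\<lambda>n. f z (n, k)) sums ((zeta (real (k + 2)) - 1) * z ^ (k + 2) / real (k + 2))"
      using Z[of z] unfolding f_eq by (simp only: mult_ac times_divide_eq_left times_divide_eq_right)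
    show "summable (\<lambda>n. norm (f z (n, k)))"
      unfolding norm_f unfolding f_eq using Z by (rule sums_summable)
  qed
  have "((\<lambda>k. (zeta (real (k + 2)) - 1) * z ^ (k + 2) / real (k + 2)) has_sum S) UNIV"
    by (rule has_sum_SigmaD[OF S']) (use col in simp)
  thus ?thesis unfolding S_eq by (rule has_sum_imp_sums)
qed

section \<open>Binet's formulas for integer indices\<close>

definition golden_conj :: real where
  "golden_conj = (1 - sqrt 5) / 2"

lemma golden_plus_conj: "golden + golden_conj = 1"
  by (simp add: golden_def golden_conj_def field_simps)

lemma golden_times_conj: "golden * golden_conj = -1"
  by (simp add: golden_def golden_conj_def field_simps)

lemma golden_bounds: "1 < golden" "golden < 2"
proof -
  have "sqrt 5 > 2" "sqrt 5 < 3" by (auto intro: real_less_rsqrt real_less_lsqrt)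
  thus "1 < golden" "golden < 2" by (auto simp: golden_def)
qed

lemma golden_neq_0: "golden \<noteq> 0" "golden_conj \<noteq> 0"
  using golden_times_conj by auto

text \<open>
  The sign conventions for negative indices fit Binet's formulas because \<open>\<alpha> \<beta> = -1\<close>: inverting
  either root gives minus the other one.
\<close>
lemma golden_powi_neg:
  "golden powi (- int n) = (-1) ^ n * golden_conj ^ n"
  "golden_conj powi (- int n) = (-1) ^ n * golden ^ n"
proof -
  have "inverse golden = - golden_conj" "inverse golden_conj = - golden"
    using golden_times_conj golden_neq_0 by (auto simp: field_simps)
  thus "golden powi (- int n) = (-1) ^ n * golden_conj ^ n"
       "golden_conj powi (- int n) = (-1) ^ n * golden ^ n"
    by (simp_all add: power_int_minus flip: power_inverse power_minus)
qed

lemma fib_int_Binet: "real_of_int (fib_int n) = (golden powi n - golden_conj powi n) / sqrt 5"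
proof (cases "n \<ge> 0")
  case True
  then obtain k where "n = int k" using nonneg_int_cases by blast
  thus ?thesis by (simp add: fib_int_def fib_closed_form golden_def golden_conj_def)
next
  case False
  then obtain k where k: "n = - int k" "k > 0"
    by (metis nonpos_int_cases linear neq0_conv of_nat_0 minus_zero)
  thus ?thesis
    by (simp add: fib_int_def fib_closed_form golden_powi_neg flip: golden_def golden_conj_def)
       (simp add: field_simps)
qed

lemma lucas_Binet: "real (lucas n) = golden ^ n + golden_conj ^ n"
proof (induction n rule: lucas.induct)
  case (3 n)
  have "golden ^ 2 = golden + 1" "golden_conj ^ 2 = golden_conj + 1"
    by (simp_all add: golden_def golden_conj_def power2_eq_square field_simps)
  thus ?case using 3 by (simp add: power2_eq_square mult.assoc[symmetric] algebra_simps)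
qed (use golden_plus_conj in auto)

lemma lucas_int_Binet: "real_of_int (lucas_int n) = golden powi n + golden_conj powi n"
proof (cases "n \<ge> 0")
  case True
  then obtain k where "n = int k" using nonneg_int_cases by blast
  thus ?thesis by (simp add: lucas_int_def lucas_Binet)
next
  case False
  then obtain k where k: "n = - int k" "k > 0"
    by (metis nonpos_int_cases linear neq0_conv of_nat_0 minus_zero)
  thus ?thesis
    by (simp add: lucas_int_def lucas_Binet golden_powi_neg algebra_simps)
qed

section \<open>The Gamma values at the two roots\<close>

lemma Gamma_reflection_real: "Gamma x * Gamma (1 - x) = pi / sin (pi * x)" for x :: real
proof -
  have "complex_of_real (Gamma x * Gamma (1 - x)) = complex_of_real (pi / sin (pi * x))"
    using Gamma_reflection_complex[of "complex_of_real x"]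
    by (simp flip: Gamma_complex_of_real sin_of_real)
  thus ?thesis by (simp only: of_real_eq_iff)
qed

text \<open>
  Both Gamma values are positive, so the reflection formula also shows that the argument of
  the logarithm on the right is positive and the logarithm splits.
\<close>
lemma ln_Gamma_two_minus_golden:
  "ln (Gamma (2 - golden)) =
     ln golden + ln (- (pi / golden ^ 2) * sec (sqrt 5 * pi / 2)) - ln (Gamma golden)"
proof -
  have pos: "Gamma golden > 0" "Gamma (2 - golden) > 0" "golden > 0"
    using golden_bounds by (auto intro: Gamma_real_pos)
  have "1 - golden \<notin> \<int>"
  proof
    assume "1 - golden \<in> \<int>"
    then obtain j where "1 - golden = of_int j" by (rule Ints_cases)
    hence "-1 < j" "j < 0" using golden_bounds by linarith+
    thus False by simp
  qed
  hence shift: "Gamma (2 - golden) = (1 - golden) * Gamma (1 - golden)"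
    using Gamma_plus1[of "1 - golden"] nonpos_Ints_Int by fastforce
  have inv: "1 - golden = - 1 / golden"
  proof -
    have "golden_conj = 1 - golden" using golden_plus_conj by simp
    hence "(1 - golden) * golden = -1" using golden_times_conj by (simp only: mult.commute)
    thus ?thesis using golden_neq_0(1) by (metis nonzero_eq_divide_eq)
  qed
  have sin_eq: "sin (pi * golden) = cos (sqrt 5 * pi / 2)"
  proof -
    have "pi * golden = pi / 2 + sqrt 5 * pi / 2" by (simp add: golden_def field_simps)
    thus ?thesis by (simp add: sin_add)
  qed
  have "Gamma golden * Gamma (2 - golden) = (1 - golden) * (Gamma golden * Gamma (1 - golden))"
    unfolding shift by (rule mult.left_commute)
  also have "\<dots> = (- 1 / golden) * (pi / cos (sqrt 5 * pi / 2))"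
    unfolding Gamma_reflection_real sin_eq unfolding inv ..
  also have "\<dots> = golden * (- (pi / golden ^ 2) * sec (sqrt 5 * pi / 2))"
    using pos by (simp add: sec_def power2_eq_square)
  finally have prod_eq: "Gamma golden * Gamma (2 - golden)
      = golden * (- (pi / golden ^ 2) * sec (sqrt 5 * pi / 2))" .
  hence "- (pi / golden ^ 2) * sec (sqrt 5 * pi / 2) > 0"
    using pos by (metis mult_pos_pos zero_less_mult_pos)
  with prod_eq have "ln (Gamma golden) + ln (Gamma (2 - golden))
      = ln golden + ln (- (pi / golden ^ 2) * sec (sqrt 5 * pi / 2))"
    using pos by (metis ln_mult_pos)
  thus ?thesis by simp
qed

lemma ln_Gamma_two_minus_golden_conj:
  "ln (Gamma (2 - golden_conj)) = ln golden + ln (Gamma golden)"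
proof -
  have "2 - golden_conj = golden + 1" using golden_plus_conj by simp
  moreover have pos: "golden > 0" using golden_bounds by simp
  moreover from this have "golden \<notin> \<int>\<^sub>\<le>\<^sub>0" using nonpos_Ints_nonpos by fastforce
  hence "Gamma (golden + 1) = golden * Gamma golden" by (rule Gamma_plus1)
  ultimately show ?thesis
    using ln_mult_pos[OF pos Gamma_real_pos[OF pos]] by metis
qed

section \<open>The Fibonacci and Lucas series\<close>

lemma zeta_powi_sums:
  fixes x :: real and j :: int
  assumes "\<bar>x\<bar> < 2" "x \<noteq> 0"
  shows "(\<lambda>k. (zeta (real (k + 2)) - 1) * x powi (int (k + 2) + j) / real (k + 2))
           sums (x powi j * ln (Gamma (2 - x)) + (1 - euler_mascheroni) * x powi (j + 1))"
proof -
  have "(\<lambda>k. x powi j * ((zeta (real (k + 2)) - 1) * x ^ (k + 2) / real (k + 2)))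
          sums (x powi j * (ln (Gamma (2 - x)) + (1 - euler_mascheroni) * x))"
    by (intro sums_mult zeta_minus_one_generating_function assms)
  moreover have "x powi (int (k + 2) + j) = x powi j * x ^ (k + 2)" for k
    using assms(2) by (subst power_int_add) (simp_all only: power_int_of_nat mult.commute simp_thms)
  moreover have "x powi (j + 1) = x powi j * x"
    using assms(2) by (simp add: power_int_add)
  ultimately show ?thesis by (simp add: algebra_simps)
qed

theorem theorem3p3:
  fixes m :: int
  assumes "m \<ge> 0"
  shows "((\<lambda>k. (zeta (real (k + 2)) - 1) * real_of_int (fib_int (int (k + 2) + m - 1)) / real (k + 2))
           sums ((1 - euler_mascheroni) * real_of_int (fib_int m)
                 - ln (Gamma golden) / sqrt 5 * real_of_int (lucas_int (m - 1))
                 + real_of_int (fib_int (m - 1)) * ln golden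
                 + golden powi (m - 1) / sqrt 5
                     * ln (- (pi / golden ^ 2) * sec (sqrt 5 * pi / 2))))
       \<and> ((\<lambda>k. (zeta (real (k + 2)) - 1) * real_of_int (lucas_int (int (k + 2) + m - 1)) / real (k + 2))
           sums ((1 - euler_mascheroni) * real_of_int (lucas_int m)
                 - sqrt 5 * ln (Gamma golden) * real_of_int (fib_int (m - 1))
                 + real_of_int (lucas_int (m - 1)) * ln golden
                 + golden powi (m - 1)
                     * ln (- (pi / golden ^ 2) * sec (sqrt 5 * pi / 2))))"
proof -
  have "\<bar>golden\<bar> < 2" "\<bar>golden_conj\<bar> < 2"
    using golden_bounds golden_plus_conj by auto
  define c where "c = (\<lambda>k. (zeta (real (k + 2)) - 1) / real (k + 2))"
  define A where "A = golden powi (m - 1)"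
  define B where "B = golden_conj powi (m - 1)"
  define G where "G = ln (Gamma golden)"
  define R where "R = ln (- (pi / golden ^ 2) * sec (sqrt 5 * pi / 2))"
  have shift: "int (k + 2) + m - 1 = int (k + 2) + (m - 1)" for k
    by simp
  have a: "(\<lambda>k. c k * golden powi (int (k + 2) + m - 1))
      sums (A * (ln golden + R - G) + (1 - euler_mascheroni) * golden powi m)"
    using zeta_powi_sums[of golden "m - 1"] \<open>\<bar>golden\<bar> < 2\<close> golden_neq_0
    unfolding shift ln_Gamma_two_minus_golden by (simp add: A_def G_def R_def c_def)
  have b: "(\<lambda>k. c k * golden_conj powi (int (k + 2) + m - 1))
      sums (B * (ln golden + G) + (1 - euler_mascheroni) * golden_conj powi m)"
    using zeta_powi_sums[of golden_conj "m - 1"] \<open>\<bar>golden_conj\<bar> < 2\<close> golden_neq_0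
    unfolding shift ln_Gamma_two_minus_golden_conj by (simp add: B_def G_def c_def)
  have "(\<lambda>k. c k * real_of_int (fib_int (int (k + 2) + m - 1)))
          sums (((A * (ln golden + R - G) + (1 - euler_mascheroni) * golden powi m)
                - (B * (ln golden + G) + (1 - euler_mascheroni) * golden_conj powi m)) / sqrt 5)"
    using sums_divide[OF sums_diff[OF a b], of "sqrt 5"]
    by (simp only: fib_int_Binet right_diff_distrib times_divide_eq_right)
  moreover have "(\<lambda>k. c k * real_of_int (lucas_int (int (k + 2) + m - 1)))
          sums ((A * (ln golden + R - G) + (1 - euler_mascheroni) * golden powi m)
                + (B * (ln golden + G) + (1 - euler_mascheroni) * golden_conj powi m))"
    using sums_add[OF a b] by (simp only: lucas_int_Binet distrib_left)
  moreover have "((A * (ln golden + R - G) + (1 - euler_mascheroni) * golden powi m)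
                - (B * (ln golden + G) + (1 - euler_mascheroni) * golden_conj powi m)) / sqrt 5
      = (1 - euler_mascheroni) * real_of_int (fib_int m)
        - G / sqrt 5 * real_of_int (lucas_int (m - 1))
        + real_of_int (fib_int (m - 1)) * ln golden + A / sqrt 5 * R"
    unfolding fib_int_Binet lucas_int_Binet A_def[symmetric] B_def[symmetric]
    by (simp add: field_simps)
  moreover have "(A * (ln golden + R - G) + (1 - euler_mascheroni) * golden powi m)
                + (B * (ln golden + G) + (1 - euler_mascheroni) * golden_conj powi m)
      = (1 - euler_mascheroni) * real_of_int (lucas_int m)
        - sqrt 5 * G * real_of_int (fib_int (m - 1))
        + real_of_int (lucas_int (m - 1)) * ln golden + A * R"
    unfolding fib_int_Binet lucas_int_Binet A_def[symmetric] B_def[symmetric]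
    by (simp add: algebra_simps diff_divide_distrib)
  ultimately show ?thesis
    unfolding A_def G_def R_def c_def by (simp only: times_divide_eq_left)
qed

end
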